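(* Let $K$ be an algebraically closed field of characteristic zero. Let $S\le\mathfrak I_n$ be an inverse subsemigroup containing all the idempotents of $\mathfrak I_n$ and let $G$ be a finite group. Let $p\ge 1$ and let $\theta^p$ be the character of the $p$-th tensor power of the representation of $G\wr S\le \mathfrak I_{G\times[n]}\cong\mathfrak I_{|G|n}$ by rook matrices. Let $X\subseteq[n]$ with $|X|=r$ and let $G_X$ be the maximal subgroup of $S$ at $1_X$. Let $\chi\in\mathrm{Irr}(G\wr G_X)$, where $G\wr G_X$ is identified with the maximal subgroup of $G\wr S$ at the idempotent $1_{G\times X}$. Then \[(\chi,\theta^p)_{G\wr S}=\frac{1}{|G|^{r-p}\,|G_X|}\deg(\chi)\,r!\,S(p,r).\] In particular, for $S=\mathfrak I_n$, \[(\chi,\theta^p)_{G\wr S}=\frac{1}{|G|^{r-p}}\deg(\chi)\,S(p,r).\]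
   Context: $[n]=\{1,\dots,n\}$. For a finite set $Y$, $\mathfrak I_Y$ is the monoid of all partial permutations of $Y$ (bijections between subsets of $Y$, including the empty one), acting on the right of $Y$ and composed as partial functions; $\mathfrak I_n=\mathfrak I_{[n]}$. An inverse subsemigroup is a subsemigroup closed under $\sigma\mapsto\sigma^{-1}$. The idempotents of $\mathfrak I_Y$ are the partial identities $1_Z$, $Z\subseteq Y$. For an inverse semigroup $T$ of partial permutations, $E(T)$ is its set of idempotents, ordered by restriction ($1_Z\le 1_{Z'}$ iff $Z\subseteq Z'$). The maximal subgroup of $T$ at $1_Z\in E(T)$ is the group of all elements of $T$ with domain and range both $Z$. The rook matrix representation of $T\le\mathfrak I_Y$ sends $\sigma$ to the $Y\times Y$ matrix over $K$ with $(i,j)$ entry $1$ if $i\sigma=j$ and $0$ otherwise. Wreath product: $G\wr S$ is the inverse semigroup of all partial permutations of $G\times[n]$ of the form $(f,\sigma)$ with $\sigma\in S$, $f:[n]\to G$, where $(g,i)(f,\sigma)=(gf(i),i\sigma)$ if $i\sigma$ is defined, and is undefined otherwise. Its idempotents are the $1_{G\times Z}$, $Z\subseteq[n]$; its maximal subgroup at $1_{G\times X}$ consists of the elements $(f,\sigma)$ with $\sigma\in G_X$, and is the group wreath product $G\wr G_X$, of order $|G|^r|G_X|$. For a finite inverse semigroup $T$, $e\in E(T)$ with maximal subgroup $G_e$, $\chi$ an irreducible character of $G_e$ over $K$ and $\theta$ a character of $T$ over $K$: \[(\chi,\theta)_T=\sum_{f\in E(T),\,f\le e}\Big(\frac1{|G_e|}\sum_{g\in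 G_e}\chi(g^{-1})\theta(fg)\Big)\mu(f,e),\] where $\mu$ is the M\"obius function of the poset $E(T)$. $\mathrm{Irr}(H)$ is the set of irreducible characters of $H$ over $K$, and $\deg(\chi)=\chi(1)$. $S(p,r)$ denotes the Stirling number of the second kind, $S(p,r)=\frac1{r!}\sum_{k=0}^r(-1)^{r-k}\binom rk k^p$. *)

theory Defs
  imports
    "Jordan_Normal_Form.VS_Connect"
    "HOL-Combinatorics.Stirling"
begin

section \<open>Partial permutations\<close>

text \<open>
  A partial function on \<open>Y\<close> is a map \<open>\<sigma> :: 'a \<rightharpoonup> 'a\<close> with domain and range inside \<open>Y\<close>;
  \<open>i\<sigma> = j\<close> is \<open>\<sigma> i = Some j\<close>. Partial permutations act on the right, so the product
  \<open>\<sigma>\<tau>\<close> applies \<open>\<sigma>\<close> first. The partial identity on \<open>Z\<close> is \<open>Some |` Z\<close>.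
\<close>

definition partial_perms :: "'a set \<Rightarrow> ('a \<rightharpoonup> 'a) set" where
  "partial_perms Y = {\<sigma>. dom \<sigma> \<subseteq> Y \<and> ran \<sigma> \<subseteq> Y \<and> inj_on \<sigma> (dom \<sigma>)}"

definition pcomp :: "('a \<rightharpoonup> 'a) \<Rightarrow> ('a \<rightharpoonup> 'a) \<Rightarrow> ('a \<rightharpoonup> 'a)" where
  "pcomp \<sigma> \<tau> = \<tau> \<circ>\<^sub>m \<sigma>"

definition pinv :: "('a \<rightharpoonup> 'a) \<Rightarrow> ('a \<rightharpoonup> 'a)" where
  "pinv \<sigma> = (\<lambda>y. if y \<in> ran \<sigma> then Some (THE x. \<sigma> x = Some y) else None)"

abbreviation pid :: "'a set \<Rightarrow> ('a \<rightharpoonup> 'a)" where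
  "pid Z \<equiv> Some |` Z"

definition inverse_subsemigroup :: "('a \<rightharpoonup> 'a) set \<Rightarrow> 'a set \<Rightarrow> bool" where
  "inverse_subsemigroup S Y \<longleftrightarrow>
     S \<subseteq> partial_perms Y \<and> (\<forall>\<sigma>\<in>S. \<forall>\<tau>\<in>S. pcomp \<sigma> \<tau> \<in> S) \<and> (\<forall>\<sigma>\<in>S. pinv \<sigma> \<in> S)"

definition idempotents :: "('a \<rightharpoonup> 'a) set \<Rightarrow> ('a \<rightharpoonup> 'a) set" where
  "idempotents T = {e \<in> T. pcomp e e = e}"

text \<open>The order on idempotents is restriction of partial functions, i.e. \<open>\<subseteq>\<^sub>m\<close>.\<close>

definition idem_order :: "('a \<rightharpoonup> 'a) set \<Rightarrow> ('a \<rightharpoonup> 'a) rel" where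
  "idem_order T = {(e, f). e \<in> idempotents T \<and> f \<in> idempotents T \<and> e \<subseteq>\<^sub>m f}"

definition max_subgroup :: "('a \<rightharpoonup> 'a) set \<Rightarrow> ('a \<rightharpoonup> 'a) \<Rightarrow> ('a \<rightharpoonup> 'a) monoid" where
  "max_subgroup T e =
     \<lparr>carrier = {\<sigma> \<in> T. dom \<sigma> = dom e \<and> ran \<sigma> = dom e}, mult = pcomp, one = e\<rparr>"


section \<open>Wreath products\<close>

definition wreath_elem :: "('g, 'b) monoid_scheme \<Rightarrow> ('i \<Rightarrow> 'g) \<Rightarrow> ('i \<rightharpoonup> 'i) \<Rightarrow> ('g \<times> 'i \<rightharpoonup> 'g \<times> 'i)"
  where "wreath_elem G f \<sigma> = (\<lambda>(g, i).
     if g \<in> carrier G then map_option (\<lambda>j. (g \<otimes>\<^bsub>G\<^esub> f i, j)) (\<sigma> i) else None)"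

definition wreath :: "('g, 'b) monoid_scheme \<Rightarrow> 'i set \<Rightarrow> ('i \<rightharpoonup> 'i) set \<Rightarrow> ('g \<times> 'i \<rightharpoonup> 'g \<times> 'i) set"
  where "wreath G I S = {wreath_elem G f \<sigma> | f \<sigma>. f \<in> I \<rightarrow> carrier G \<and> \<sigma> \<in> S}"

lemma dom_wreath_elem: "dom (wreath_elem G f \<sigma>) = carrier G \<times> dom \<sigma>"
  by (auto simp: wreath_elem_def dom_def split: if_splits)

lemma ran_wreath_elem:
  assumes "group G" "f \<in> I \<rightarrow> carrier G" "dom \<sigma> \<subseteq> I"
  shows "ran (wreath_elem G f \<sigma>) = carrier G \<times> ran \<sigma>"
proof -
  interpret group G by fact
  { fix h i j assume h: "h \<in> carrier G" and s: "\<sigma> i = Some j"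
    then have "f i \<in> carrier G" using assms by auto
    then have "wreath_elem G f \<sigma> (h \<otimes>\<^bsub>G\<^esub> inv\<^bsub>G\<^esub> f i, i) = Some (h, j)"
      using h s by (simp add: wreath_elem_def m_assoc) 
    then have "(h, j) \<in> ran (wreath_elem G f \<sigma>)" by (rule ranI) }
  then show ?thesis using assms(2,3)
    by (force simp: ran_def wreath_elem_def split: if_splits)
qed

text \<open>
  The identification of the maximal subgroup at \<open>1\<^bsub>G \<times> X\<^esub>\<close> with the group wreath product
  \<open>G \<wr> G\<^sub>X\<close>; as sets of partial permutations the two are equal.
\<close>

lemma carrier_max_subgroup_wreath:
  assumes "group G" "inverse_subsemigroup S I" "X \<subseteq> I"
  shows "carrier (max_subgroup (wreath G I S) (pid (carrier G \<times> X))) =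
    wreath G X (carrier (max_subgroup S (pid X)))" (is "?L = ?R")
proof -
  interpret group G by fact
  have ne: "carrier G \<noteq> {}" by blast
  have d: "dom \<sigma> \<subseteq> I" if "\<sigma> \<in> S" for \<sigma>
    using assms(2) that by (auto simp: inverse_subsemigroup_def partial_perms_def)
  show ?thesis
  proof
    show "?L \<subseteq> ?R"
    proof
      fix w assume "w \<in> ?L"
      then obtain f \<sigma> where w: "w = wreath_elem G f \<sigma>" "f \<in> I \<rightarrow> carrier G" "\<sigma> \<in> S"
        "dom w = carrier G \<times> X" "ran w = carrier G \<times> X"
        by (auto simp: max_subgroup_def wreath_def)
      have "dom \<sigma> = X" using w ne dom_wreath_elem[of G f \<sigma>] by (auto simp: Times_eq_cancel2)
      moreover have "ran \<sigma> = X" using w ne ran_wreath_elem[OF assms(1) w(2) d[OF w(3)]] by auto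
      moreover have "f \<in> X \<rightarrow> carrier G" using w(2) assms(3) by blast
      ultimately show "w \<in> ?R" using w(1,3)
        unfolding wreath_def max_subgroup_def by fastforce
    qed
    show "?R \<subseteq> ?L"
    proof
      fix w assume "w \<in> ?R"
      then obtain f \<sigma> where w: "w = wreath_elem G f \<sigma>" "f \<in> X \<rightarrow> carrier G" "\<sigma> \<in> S"
         "dom \<sigma> = X" "ran \<sigma> = X" by (auto simp: max_subgroup_def wreath_def)
      define f' where "f' = (\<lambda>i. if i \<in> X then f i else \<one>\<^bsub>G\<^esub>)"
      have "\<sigma> i = None" if "i \<notin> X" for i using w that by (auto simp: dom_def)
      then have "w = wreath_elem G f' \<sigma>" unfolding w(1)
        by (force simp: wreath_elem_def f'_def fun_eq_iff)
      moreover have "f' \<in> I \<rightarrow> carrier G" using w(2) by (auto simp: f'_def)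
      ultimately show "w \<in> ?L" 
        using w ran_wreath_elem[OF assms(1) \<open>f' \<in> I \<rightarrow> _\<close> d[OF w(3)]]
        by (auto simp: max_subgroup_def wreath_def dom_wreath_elem)
    qed
  qed
qed


section \<open>Representations and characters\<close>

text \<open>Trace of a matrix whose rows and columns are indexed by the finite set \<open>I\<close>.\<close>

definition trace_on :: "'i set \<Rightarrow> ('i \<Rightarrow> 'i \<Rightarrow> 'k::comm_ring_1) \<Rightarrow> 'k" where
  "trace_on I M = (\<Sum>i\<in>I. M i i)"

definition group_rep :: "('h, 'b) monoid_scheme \<Rightarrow> nat \<Rightarrow> ('h \<Rightarrow> 'k::field mat) \<Rightarrow> bool" where
  "group_rep H d \<rho> \<longleftrightarrow>
     (\<forall>x\<in>carrier H. \<rho> x \<in> carrier_mat d d) \<and>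
     \<rho> \<one>\<^bsub>H\<^esub> = 1\<^sub>m d \<and>
     (\<forall>x\<in>carrier H. \<forall>y\<in>carrier H. \<rho> (x \<otimes>\<^bsub>H\<^esub> y) = \<rho> x * \<rho> y)"

definition irreducible_rep :: "('h, 'b) monoid_scheme \<Rightarrow> nat \<Rightarrow> ('h \<Rightarrow> 'k::field mat) \<Rightarrow> bool" where
  "irreducible_rep H d \<rho> \<longleftrightarrow> group_rep H d \<rho> \<and> d \<noteq> 0 \<and>
     (\<forall>W. VectorSpace.subspace class_ring W (module_vec TYPE('k) d) \<and>
          (\<forall>x\<in>carrier H. \<forall>v\<in>W. \<rho> x *\<^sub>v v \<in> W)
          \<longrightarrow> W = {0\<^sub>v d} \<or> W = carrier_vec d)"

text \<open>Characters are functions on the group, hence made \<open>undefined\<close> off the carrier.\<close>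

definition Irr :: "('h, 'b) monoid_scheme \<Rightarrow> ('h \<Rightarrow> 'k::field) set" where
  "Irr H = {(\<lambda>x\<in>carrier H. trace_on {..<d} (\<lambda>i j. \<rho> x $$ (i, j))) | d \<rho>. irreducible_rep H d \<rho>}"

definition char_degree :: "('h, 'b) monoid_scheme \<Rightarrow> ('h \<Rightarrow> 'k) \<Rightarrow> 'k" where
  "char_degree H \<chi> = \<chi> \<one>\<^bsub>H\<^esub>"

definition rook :: "('a \<rightharpoonup> 'a) \<Rightarrow> 'a \<Rightarrow> 'a \<Rightarrow> 'k::comm_ring_1" where
  "rook \<sigma> i j = (if \<sigma> i = Some j then 1 else 0)"

text \<open>
  The basis of the \<open>p\<close>-th tensor power of the space with basis \<open>Y\<close> consists of the \<open>p\<close>-tuples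
  over \<open>Y\<close>, encoded as lists of length \<open>p\<close>; \<open>tensor_power p M\<close> is the Kronecker power of \<open>M\<close>.
\<close>

definition tuples :: "'a set \<Rightarrow> nat \<Rightarrow> 'a list set" where
  "tuples Y p = {xs. set xs \<subseteq> Y \<and> length xs = p}"

definition tensor_power :: "nat \<Rightarrow> ('a \<Rightarrow> 'a \<Rightarrow> 'k::comm_ring_1) \<Rightarrow> 'a list \<Rightarrow> 'a list \<Rightarrow> 'k" where
  "tensor_power p M xs ys = (\<Prod>k<p. M (xs ! k) (ys ! k))"

definition rook_tensor_char :: "'a set \<Rightarrow> nat \<Rightarrow> ('a \<rightharpoonup> 'a) \<Rightarrow> 'k::comm_ring_1" where
  "rook_tensor_char Y p \<sigma> = trace_on (tuples Y p) (tensor_power p (rook \<sigma>))"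


section \<open>The bracket of a group character and a semigroup character\<close>

text \<open>
  Moebius function of a finite partial order given as a relation:
  \<open>\<mu>(x, x) = 1\<close> and \<open>\<mu>(x,y) = -\<Sum>\<^bsub>x \<le> z < y\<^esub> \<mu>(x,z)\<close> for \<open>x < y\<close>. The value is \<open>0\<close> if \<open>r\<close> is
  not a finite partial order or \<open>(x, y) \<notin> r\<close>.
\<close>

function mobius :: "'a rel \<Rightarrow> 'a \<Rightarrow> 'a \<Rightarrow> int" where
  "mobius r x y =
     (if finite r \<and> Partial_order r \<and> (x, y) \<in> r
      then if x = y then 1
           else - (\<Sum>z\<in>{z. (x, z) \<in> r \<and> (z, y) \<in> r \<and> z \<noteq> y}. mobius r x z)
      else 0)"
  by auto
termination
proof (relation "Wellfounded.measure (\<lambda>(r, x, y). card {z. (x, z) \<in> r \<and> (z, y) \<in> r})", goal_cases)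
  case 1
  show ?case by simp
next
  case (2 r x y z)
  then have r: "finite r" "refl_on (Field r) r" "trans r" "antisym r" and xy: "(x, y) \<in> r"
    and z: "(x, z) \<in> r" "(z, y) \<in> r" "z \<noteq> y"
    by (auto dest: partial_order_onD)
  have "(y, y) \<in> r"
    using r(2) xy by (auto simp: refl_on_def Field_def)
  moreover have "(y, z) \<notin> r"
    using r(4) z by (auto dest: antisymD)
  ultimately have "{w. (x, w) \<in> r \<and> (w, z) \<in> r} \<subset> {w. (x, w) \<in> r \<and> (w, y) \<in> r}"
    using r(3) z xy by (auto dest: transD)
  moreover have "finite {w. (x, w) \<in> r \<and> (w, y) \<in> r}"
    by (rule finite_subset[OF _ finite_imageI[OF r(1), of snd]]) force
  ultimately show ?case
    by (simp add: psubset_card_mono)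
qed

declare mobius.simps [simp del]

definition bracket ::
  "('a \<rightharpoonup> 'a) set \<Rightarrow> ('a \<rightharpoonup> 'a) \<Rightarrow> (('a \<rightharpoonup> 'a) \<Rightarrow> 'k::field) \<Rightarrow> (('a \<rightharpoonup> 'a) \<Rightarrow> 'k) \<Rightarrow> 'k" where
  "bracket T e \<chi> \<theta> =
     (\<Sum>f\<in>{f \<in> idempotents T. f \<subseteq>\<^sub>m e}.
        (1 / of_nat (card (carrier (max_subgroup T e))) *
           (\<Sum>g\<in>carrier (max_subgroup T e). \<chi> (pinv g) * \<theta> (pcomp f g)))
        * of_int (mobius (idem_order T) f e))"

end

theory Submission
  imports Defs "HOL-Combinatorics.Permutations"
begin

text \<open>
  The rook representation is a permutation representation, which turns the bracket into a count.
  The value \<open>\<theta>\<^sup>p(w)\<close> is the number of \<open>p\<close>-tuples over \<open>G \<times> [n]\<close> all of whose entries are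
  fixed by \<open>w\<close>. Multiplying \<open>w\<close> by an idempotent \<open>1\<^bsub>G \<times> Z\<^esub>\<close> counts those tuples whose set of
  second components (the \<^emph>\<open>support\<close>) lies in \<open>Z\<close>. The idempotents below \<open>1\<^bsub>G \<times> X\<^esub>\<close>
  are the \<open>1\<^bsub>G \<times> Z\<^esub>\<close> with \<open>Z \<subseteq> X\<close>, so their poset is a Boolean lattice with Moebius function
  \<open>(-1)\<^bsup>|X| - |Z|\<^esup>\<close>, and the sum over idempotents in the bracket is
  inclusion-exclusion: it leaves the tuples with support exactly \<open>X\<close>.

  An element \<open>(f,\<sigma>)\<close> of \<open>G \<wr> G\<^sub>X\<close> that fixes one point \<open>(g,i)\<close> of the fibre over \<open>i\<close> satisfies
  \<open>i\<sigma> = i\<close> and \<open>f(i) = 1\<close>. If it fixes every entry of a tuple with support \<open>X\<close>, it is therefore the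
  identity (\<open>fixing_full_support_imp_id\<close>). So only the identity contributes to the average over
  the maximal subgroup \<open>H\<close>, and the bracket equals \<open>\<chi>(1) N / |H|\<close>, where \<open>N\<close> is the number of all
  \<open>p\<close>-tuples over \<open>G \<times> X\<close> with support \<open>X\<close> (\<open>bracket_eq_card_full_support\<close>). Such a
  tuple is a word of length \<open>p\<close> over \<open>G\<close> together with a surjective word of length \<open>p\<close> over \<open>X\<close>,
  whence \<open>N = |G|\<^sup>p r! S(p,r)\<close>; and \<open>|H| = |G|\<^sup>r |G\<^sub>X|\<close>.
\<close>

section \<open>Counting words with full support\<close>

lemma finite_tuples: "finite Y \<Longrightarrow> finite (tuples Y p)"
  unfolding tuples_def by (rule finite_lists_length_eq)

text \<open>
  Removing the first letter \<open>y\<close> of a surjective word over \<open>X\<close> leaves a surjective word over \<open>X\<close> or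
  over \<open>X - {y}\<close>. Hence the count satisfies the Stirling recurrence multiplied by \<open>r!\<close>.
\<close>

lemma card_surjective_words:
  assumes "finite X"
  shows "card {xs. length xs = p \<and> set xs = X} = fact (card X) * Stirling p (card X)"
  using assms
proof (induction p arbitrary: X)
  case 0
  then show ?case
    by (cases "card X") (auto simp: card_eq_0_iff cong: conj_cong)
next
  case (Suc p)
  let ?W = "\<lambda>A. {xs. length xs = p \<and> set xs = (A::'a set)}"
  have fin: "finite (?W A)" if "finite A" for A
    by (rule finite_subset[OF _ finite_lists_length_eq[OF that, of p]]) auto
  have split: "{xs. length xs = Suc p \<and> set xs = X} =
      (\<Union>y\<in>X. (#) y ` (?W X \<union> ?W (X - {y})))"
    by (fastforce simp: length_Suc_conv)
  have "card {xs. length xs = Suc p \<and> set xs = X} =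
      (\<Sum>y\<in>X. card (?W X \<union> ?W (X - {y})))"
    unfolding split using Suc.prems
    by (subst card_UN_disjoint) (auto simp: fin card_image)
  also have "\<dots> = (\<Sum>y\<in>X. card (?W X) + card (?W (X - {y})))"
    using Suc.prems by (intro sum.cong refl card_Un_disjoint) (auto simp: fin)
  also have "\<dots> = (\<Sum>y\<in>X. fact (card X) * Stirling p (card X)
      + fact (card X - 1) * Stirling p (card X - 1))"
    using Suc.prems by (intro sum.cong refl) (simp add: Suc.IH card_Diff_singleton)
  also have "\<dots> = fact (card X) * Stirling (Suc p) (card X)"
    by (cases "card X") (simp_all add: algebra_simps)
  finally show ?case .
qed

lemma card_full_support_tuples:
  assumes "finite A" "finite X"
  shows "card {t \<in> tuples (A \<times> X) p. snd ` set t = X} =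
    card A ^ p * (fact (card X) * Stirling p (card X))"
proof -
  let ?L = "{as. set as \<subseteq> A \<and> length as = p}"
  let ?R = "{xs. length xs = p \<and> set xs = X}"
  have "bij_betw (\<lambda>t. (map fst t, map snd t)) {t \<in> tuples (A \<times> X) p. snd ` set t = X} (?L \<times> ?R)"
  proof (rule bij_betw_byWitness[where f' = "\<lambda>(as, xs). zip as xs"])
    show "\<forall>t\<in>{t \<in> tuples (A \<times> X) p. snd ` set t = X}.
        (\<lambda>(as, xs). zip as xs) (map fst t, map snd t) = t"
      by (simp add: zip_map_fst_snd)
    show "\<forall>q\<in>?L \<times> ?R. (map fst ((\<lambda>(as, xs). zip as xs) q), map snd ((\<lambda>(as, xs). zip as xs) q)) = q"
      by auto
    show "(\<lambda>t. (map fst t, map snd t)) ` {t \<in> tuples (A \<times> X) p. snd ` set t = X} \<subseteq> ?L \<times> ?R"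
      by (fastforce simp: tuples_def)
    show "(\<lambda>(as, xs). zip as xs) ` (?L \<times> ?R) \<subseteq> {t \<in> tuples (A \<times> X) p. snd ` set t = X}"
    proof
      fix t assume "t \<in> (\<lambda>(as, xs). zip as xs) ` (?L \<times> ?R)"
      then obtain as xs where t: "t = zip as xs" "set as \<subseteq> A" "length as = p"
          and xs: "length xs = p" "set xs = X" by auto
      then have "snd ` set t = X"
        by (metis list.set_map map_snd_zip)
      then show "t \<in> {t \<in> tuples (A \<times> X) p. snd ` set t = X}"
        using t xs by (auto simp: tuples_def dest: set_zip_leftD set_zip_rightD)
    qed
  qed
  then show ?thesis
    using assms by (simp add: bij_betw_same_card card_cartesian_product
        card_surjective_words card_lists_length_eq)
qed

text \<open>
  Inclusion-exclusion for the support of a tuple; \<open>F\<close> is later the set of tuples fixed by a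
  given element of the maximal subgroup.
\<close>

lemma card_full_support_inclusion_exclusion:
  fixes F :: "('a \<times> 'i) list set"
  assumes "finite F" "finite X"
  shows "(of_nat (card {t \<in> F. snd ` set t = X}) :: 'k::ring_1) =
    (\<Sum>Z\<in>Pow X. (-1) ^ (card X - card Z) * of_nat (card {t \<in> F. snd ` set t \<subseteq> Z}))"
proof (rule inclusion_exclusion_mobius[OF _ assms(2)])
  fix Z :: "'i set" assume "finite Z"
  have "{t \<in> F. snd ` set t \<subseteq> Z} = (\<Union>W\<in>Pow Z. {t \<in> F. snd ` set t = W})"
    by auto
  then have "card {t \<in> F. snd ` set t \<subseteq> Z} = (\<Sum>W\<in>Pow Z. card {t \<in> F. snd ` set t = W})"
    using \<open>finite Z\<close> assms(1) by (simp only:) (subst card_UN_disjoint, auto)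
  then show "(of_nat (card {t \<in> F. snd ` set t \<subseteq> Z}) :: 'k) =
      (\<Sum>W\<in>Pow Z. of_nat (card {t \<in> F. snd ` set t = W}))"
    by simp
qed


section \<open>The Moebius function of a Boolean lattice\<close>

text \<open>
  The map \<open>\<phi>\<close> transports the lattice of subsets of \<open>I\<close> to an isomorphic order \<open>r\<close> on another
  type; in the bracket the poset consists of partial identities. The closed form holds because it
  satisfies the defining recursion of the Moebius function: the alternating sum over an interval
  \<open>A \<subset> B\<close>, endpoints included, vanishes.
\<close>

lemma mobius_Boolean:
  assumes "finite I" and inj: "inj_on \<phi> (Pow I)"
    and r: "r = {(\<phi> A, \<phi> B) | A B. A \<subseteq> B \<and> B \<subseteq> I}"
    and "A \<subseteq> B" "B \<subseteq> I"
  shows "mobius r (\<phi> A) (\<phi> B) = (-1) ^ (card B - card A)"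
proof -
  have r_iff: "(\<phi> C, \<phi> D) \<in> r \<longleftrightarrow> C \<subseteq> D" if "C \<subseteq> I" "D \<subseteq> I" for C D
    using that inj unfolding r inj_on_def by blast
  have in_r: "\<exists>C D. u = \<phi> C \<and> v = \<phi> D \<and> C \<subseteq> D \<and> D \<subseteq> I" if "(u, v) \<in> r" for u v
    using that r by blast
  have "finite r"
    by (rule finite_subset[of _ "\<phi> ` Pow I \<times> \<phi> ` Pow I"]) (use \<open>finite I\<close> in \<open>auto simp: r\<close>)
  have "refl_on (Field r) r"
    unfolding refl_on_def Field_def r by blast
  moreover have "trans r"
  proof (rule transI)
    fix u v w assume "(u, v) \<in> r" "(v, w) \<in> r"
    with in_r obtain C D E where "u = \<phi> C" "v = \<phi> D" "w = \<phi> E" "C \<subseteq> I" "D \<subseteq> I" "E \<subseteq> I"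
      by (metis subset_trans)
    with \<open>(u, v) \<in> r\<close> \<open>(v, w) \<in> r\<close> show "(u, w) \<in> r"
      by (auto simp: r_iff)
  qed
  moreover have "antisym r"
  proof (rule antisymI)
    fix u v assume "(u, v) \<in> r" "(v, u) \<in> r"
    with in_r obtain C D where "u = \<phi> C" "v = \<phi> D" "C \<subseteq> I" "D \<subseteq> I"
      by (metis subset_trans)
    with \<open>(u, v) \<in> r\<close> \<open>(v, u) \<in> r\<close> show "u = v"
      by (auto simp: r_iff)
  qed
  ultimately have po: "Partial_order r"
    by (auto simp: partial_order_on_def preorder_on_def intro: FieldI1 FieldI2)
  show ?thesis
    using \<open>A \<subseteq> B\<close> \<open>B \<subseteq> I\<close>
  proof (induction "card B" arbitrary: B rule: less_induct)
    case less
    have finB: "finite B" using less.prems(2) \<open>finite I\<close> by (rule finite_subset)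
    show ?case
    proof (cases "A = B")
      case True
      then show ?thesis
        using less.prems \<open>finite r\<close> po by (subst mobius.simps) (simp add: r_iff)
    next
      case False
      let ?J = "{W. W \<subseteq> B \<and> A \<subseteq> W}"
      have finJ: "finite ?J" using finB by simp
      have neq: "\<phi> A \<noteq> \<phi> B"
        using False less.prems inj unfolding inj_on_def by blast
      have between: "{z. (\<phi> A, z) \<in> r \<and> (z, \<phi> B) \<in> r \<and> z \<noteq> \<phi> B} = \<phi> ` (?J - {B})"
      proof (rule Set.set_eqI)
        fix z
        show "z \<in> {z. (\<phi> A, z) \<in> r \<and> (z, \<phi> B) \<in> r \<and> z \<noteq> \<phi> B} \<longleftrightarrow> z \<in> \<phi> ` (?J - {B})"
        proof
          assume z: "z \<in> {z. (\<phi> A, z) \<in> r \<and> (z, \<phi> B) \<in> r \<and> z \<noteq> \<phi> B}"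
          then obtain W where "z = \<phi> W" "W \<subseteq> I" using in_r by blast
          with z less.prems show "z \<in> \<phi> ` (?J - {B})" by (auto simp: r_iff)
        next
          assume "z \<in> \<phi> ` (?J - {B})"
          then obtain W where W: "z = \<phi> W" "W \<subseteq> B" "A \<subseteq> W" "W \<noteq> B" by auto
          moreover have "\<phi> W \<noteq> \<phi> B"
            using W less.prems inj unfolding inj_on_def by blast
          moreover have "W \<subseteq> I" "A \<subseteq> I" using W less.prems by auto
          ultimately show "z \<in> {z. (\<phi> A, z) \<in> r \<and> (z, \<phi> B) \<in> r \<and> z \<noteq> \<phi> B}"
            using less.prems by (simp add: r_iff)
        qed
      qed
      have "inj_on \<phi> (?J - {B})"
        by (rule inj_on_subset[OF inj]) (use less.prems in auto)
      moreover have "(\<phi> A, \<phi> B) \<in> r"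
        using less.prems by (simp add: r_iff)
      ultimately have "mobius r (\<phi> A) (\<phi> B) = - (\<Sum>W\<in>?J - {B}. mobius r (\<phi> A) (\<phi> W))"
        using \<open>finite r\<close> po neq
        by (subst mobius.simps) (simp add: between sum.reindex)
      also have "(\<Sum>W\<in>?J - {B}. mobius r (\<phi> A) (\<phi> W)) = (\<Sum>W\<in>?J - {B}. (-1) ^ (card W - card A))"
      proof (intro sum.cong refl less.hyps)
        fix W assume "W \<in> ?J - {B}"
        then show "card W < card B" "A \<subseteq> W" "W \<subseteq> I"
          using finB less.prems by (auto intro: psubset_card_mono)
      qed
      also have "\<dots> = (\<Sum>W\<in>?J. (-1) ^ (card W - card A)) - (-1) ^ (card B - card A)"
        using finJ less.prems by (subst sum_diff1) auto
      \<comment> \<open>As \<open>A \<noteq> B\<close>, the interval has as many members of even as of odd cardinality.\<close>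
      also have "(\<Sum>W\<in>?J. (-1) ^ (card W - card A)) = (-1) ^ card A * (\<Sum>W\<in>?J. (-1 :: int) ^ card W)"
        unfolding sum_distrib_left
      proof (intro sum.cong refl)
        fix W assume "W \<in> ?J"
        then have "card A \<le> card W" using finB by (auto intro: card_mono finite_subset)
        then show "(-1) ^ (card W - card A) = (-1) ^ card A * (-1 :: int) ^ card W"
          by (simp add: minus_one_power_iff)
      qed
      also have "(\<Sum>W\<in>?J. (-1 :: int) ^ card W) = 0"
        using card_subsupersets_even_odd[OF finB, of A] False less.prems finJ
        by (intro sum_alternating_cancels) (auto simp: conj_assoc)
      finally show ?thesis by simp
    qed
  qed
qed


section \<open>Idempotents\<close>

lemma pid_eq_Some_iff: "pid Z x = Some y \<longleftrightarrow> x \<in> Z \<and> y = x"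
  by (auto simp: restrict_map_def)

lemma dom_pid: "dom (pid Z) = Z"
  by (auto simp: dom_def pid_eq_Some_iff)

lemma ran_pid: "ran (pid Z) = Z"
  by (auto simp: ran_def pid_eq_Some_iff)

lemma idempotent_partial_perm:
  assumes "e \<in> partial_perms Y" "pcomp e e = e"
  shows "e = pid (dom e)"
proof
  fix x
  show "e x = pid (dom e) x"
  proof (cases "e x")
    case None
    then show ?thesis by (simp add: restrict_map_def dom_def)
  next
    case (Some y)
    then have "e y = Some y"
      using fun_cong[OF assms(2), of x] by (simp add: pcomp_def map_comp_def)
    then have "x = y"
      using Some assms(1) unfolding partial_perms_def by (metis (mono_tags) domI inj_onD mem_Collect_eq)
    then show ?thesis using Some by (auto simp: restrict_map_def dom_def)
  qed
qed

lemma pid_mem_idempotents: "Z \<subseteq> Y \<Longrightarrow> pid Z \<in> idempotents (partial_perms Y)"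
  by (auto simp: idempotents_def partial_perms_def pcomp_def map_comp_def restrict_map_def
      fun_eq_iff inj_on_def ran_def split: if_splits)

lemma pid_map_le_iff: "pid Z \<subseteq>\<^sub>m pid Z' \<longleftrightarrow> Z \<subseteq> Z'"
  by (auto simp: map_le_def restrict_map_def dom_def split: if_splits)

lemma wreath_elem_one: "group G \<Longrightarrow> wreath_elem G (\<lambda>_. \<one>\<^bsub>G\<^esub>) (pid Z) = pid (carrier G \<times> Z)"
  by (auto simp: wreath_elem_def restrict_map_def fun_eq_iff group.is_monoid)

lemma wreath_elem_inj_on:
  assumes "group G" "f \<in> I \<rightarrow> carrier G" "dom \<sigma> \<subseteq> I" "inj_on \<sigma> (dom \<sigma>)"
  shows "inj_on (wreath_elem G f \<sigma>) (dom (wreath_elem G f \<sigma>))"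
proof (rule inj_onI)
  interpret group G by fact
  fix x y assume xy: "x \<in> dom (wreath_elem G f \<sigma>)" "y \<in> dom (wreath_elem G f \<sigma>)"
    and eq: "wreath_elem G f \<sigma> x = wreath_elem G f \<sigma> y"
  obtain g i h j where [simp]: "x = (g, i)" "y = (h, j)" by fastforce
  have m: "g \<in> carrier G" "h \<in> carrier G" "i \<in> dom \<sigma>" "j \<in> dom \<sigma>"
    using xy by (auto simp: dom_wreath_elem)
  then have "\<sigma> i = \<sigma> j" "g \<otimes>\<^bsub>G\<^esub> f i = h \<otimes>\<^bsub>G\<^esub> f j"
    using eq by (auto simp: wreath_elem_def)
  moreover from this(1) have "i = j" using assms(4) m by (auto dest: inj_onD)
  moreover have "f j \<in> carrier G" using m assms(2,3) by auto
  ultimately show "x = y" using m by simp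
qed

lemma wreath_subset_partial_perms:
  assumes "group G" "S \<subseteq> partial_perms I"
  shows "wreath G I S \<subseteq> partial_perms (carrier G \<times> I)"
proof
  fix w assume "w \<in> wreath G I S"
  then obtain f \<sigma> where w: "w = wreath_elem G f \<sigma>" and f: "f \<in> I \<rightarrow> carrier G" and "\<sigma> \<in> S"
    by (auto simp: wreath_def)
  with assms have s: "dom \<sigma> \<subseteq> I" "ran \<sigma> \<subseteq> I" "inj_on \<sigma> (dom \<sigma>)"
    by (auto simp: partial_perms_def)
  show "w \<in> partial_perms (carrier G \<times> I)"
    using wreath_elem_inj_on[OF assms(1) f s(1,3)] ran_wreath_elem[OF assms(1) f s(1)] s
    unfolding w partial_perms_def by (auto simp: dom_wreath_elem)
qed

lemma idempotents_wreath:
  assumes "group G" "S \<subseteq> partial_perms I" "idempotents (partial_perms I) \<subseteq> S"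
  shows "idempotents (wreath G I S) = (\<lambda>Z. pid (carrier G \<times> Z)) ` Pow I"
proof
  show "idempotents (wreath G I S) \<subseteq> (\<lambda>Z. pid (carrier G \<times> Z)) ` Pow I"
  proof
    fix e assume "e \<in> idempotents (wreath G I S)"
    then have e: "e \<in> wreath G I S" "pcomp e e = e" by (auto simp: idempotents_def)
    then obtain f \<sigma> where "e = wreath_elem G f \<sigma>" "\<sigma> \<in> S" by (auto simp: wreath_def)
    then have "dom e = carrier G \<times> dom \<sigma>" "dom \<sigma> \<subseteq> I"
      using assms(2) by (auto simp: dom_wreath_elem partial_perms_def)
    moreover have "e = pid (dom e)"
      using e wreath_subset_partial_perms[OF assms(1,2)] by (intro idempotent_partial_perm) auto
    ultimately show "e \<in> (\<lambda>Z. pid (carrier G \<times> Z)) ` Pow I" by auto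
  qed
  show "(\<lambda>Z. pid (carrier G \<times> Z)) ` Pow I \<subseteq> idempotents (wreath G I S)"
  proof clarify
    fix Z assume "Z \<subseteq> I"
    then have "pid Z \<in> S" using assms(3) pid_mem_idempotents by blast
    moreover have "(\<lambda>_. \<one>\<^bsub>G\<^esub>) \<in> I \<rightarrow> carrier G"
      using assms(1) by (simp add: group.is_monoid monoid.one_closed)
    ultimately have "pid (carrier G \<times> Z) \<in> wreath G I S"
      unfolding wreath_def
      by (intro CollectI exI[of _ "\<lambda>_. \<one>\<^bsub>G\<^esub>"] exI[of _ "pid Z"]) (simp add: wreath_elem_one[OF assms(1)])
    then show "pid (carrier G \<times> Z) \<in> idempotents (wreath G I S)"
      using pid_mem_idempotents[of "carrier G \<times> Z" UNIV] by (auto simp: idempotents_def)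
  qed
qed

lemma inj_pid_Times:
  assumes "A \<noteq> {}"
  shows "inj (\<lambda>Z. pid (A \<times> Z))"
proof (rule injI)
  fix Z Z' assume "pid (A \<times> Z) = pid (A \<times> Z')"
  then have "A \<times> Z = A \<times> Z'" by (metis dom_pid)
  moreover obtain a where "a \<in> A" using assms by blast
  ultimately show "Z = Z'" by blast
qed

lemma mobius_wreath:
  assumes "group G" "S \<subseteq> partial_perms I" "idempotents (partial_perms I) \<subseteq> S"
    and "finite I" "Z \<subseteq> X" "X \<subseteq> I"
  shows "mobius (idem_order (wreath G I S)) (pid (carrier G \<times> Z)) (pid (carrier G \<times> X)) =
    (-1) ^ (card X - card Z)"
proof (rule mobius_Boolean[where I = I])
  have ne: "carrier G \<noteq> {}" using assms(1) by (simp add: group.is_monoid monoid.carrier_not_empty)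
  then show "inj_on (\<lambda>Z. pid (carrier G \<times> Z)) (Pow I)"
    by (intro inj_on_subset[OF inj_pid_Times subset_UNIV])
  show "idem_order (wreath G I S) =
      {(pid (carrier G \<times> A), pid (carrier G \<times> B)) | A B. A \<subseteq> B \<and> B \<subseteq> I}"
  proof (intro equalityI subrelI)
    fix e f assume "(e, f) \<in> idem_order (wreath G I S)"
    then obtain A B where AB: "e = pid (carrier G \<times> A)" "f = pid (carrier G \<times> B)" "B \<subseteq> I" "e \<subseteq>\<^sub>m f"
      unfolding idem_order_def idempotents_wreath[OF assms(1-3)] by auto
    then have "A \<subseteq> B" using ne by (auto simp: pid_map_le_iff times_subset_iff)
    with AB show "(e, f) \<in> {(pid (carrier G \<times> A), pid (carrier G \<times> B)) | A B. A \<subseteq> B \<and> B \<subseteq> I}"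
      by (intro CollectI exI[of _ A] exI[of _ B]) simp
  next
    fix e f assume "(e, f) \<in> {(pid (carrier G \<times> A), pid (carrier G \<times> B)) | A B. A \<subseteq> B \<and> B \<subseteq> I}"
    then obtain A B where AB: "e = pid (carrier G \<times> A)" "f = pid (carrier G \<times> B)" "A \<subseteq> B" "B \<subseteq> I"
      by auto
    then have "e \<subseteq>\<^sub>m f" by (simp add: pid_map_le_iff Sigma_mono)
    moreover have "A \<in> Pow I" "B \<in> Pow I" using AB by auto
    ultimately show "(e, f) \<in> idem_order (wreath G I S)"
      unfolding idem_order_def idempotents_wreath[OF assms(1-3)] AB(1,2) by simp
  qed
qed (use assms in auto)


section \<open>Orders of the maximal subgroups\<close>

text \<open>
  A pair \<open>(f,\<sigma>)\<close> is recovered from its action on the points \<open>(1,i)\<close> with \<open>i \<in> X\<close>, once \<open>f\<close> is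
  normalised to be \<open>undefined\<close> outside \<open>X\<close>.
\<close>

lemma card_max_subgroup_wreath:
  assumes "group G" "finite (carrier G)" "inverse_subsemigroup S I" "X \<subseteq> I" "finite X"
  shows "card (carrier (max_subgroup (wreath G I S) (pid (carrier G \<times> X)))) =
    card (carrier G) ^ card X * card (carrier (max_subgroup S (pid X)))"
proof -
  interpret group G by fact
  let ?P = "carrier (max_subgroup S (pid X))"
  let ?w = "\<lambda>(f, \<sigma>). wreath_elem G f \<sigma>"
  have P: "dom \<sigma> = X" if "\<sigma> \<in> ?P" for \<sigma>
    using that by (simp add: max_subgroup_def)
  have outside: "\<sigma> i = None" if "\<sigma> \<in> ?P" "i \<notin> X" for \<sigma> i
    using that P by (metis domIff)
  have "wreath G X ?P = ?w ` ((X \<rightarrow>\<^sub>E carrier G) \<times> ?P)"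
  proof
    show "wreath G X ?P \<subseteq> ?w ` ((X \<rightarrow>\<^sub>E carrier G) \<times> ?P)"
    proof
      fix w assume "w \<in> wreath G X ?P"
      then obtain f \<sigma> where w: "w = wreath_elem G f \<sigma>" "f \<in> X \<rightarrow> carrier G" "\<sigma> \<in> ?P"
        by (auto simp: wreath_def)
      then have "w = ?w (restrict f X, \<sigma>)"
        using outside[OF w(3)] by (force simp: wreath_elem_def fun_eq_iff)
      then show "w \<in> ?w ` ((X \<rightarrow>\<^sub>E carrier G) \<times> ?P)"
        using w by (intro image_eqI[of _ _ "(restrict f X, \<sigma>)"]) auto
    qed
    show "?w ` ((X \<rightarrow>\<^sub>E carrier G) \<times> ?P) \<subseteq> wreath G X ?P"
      unfolding wreath_def PiE_def by fastforce
  qed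
  moreover have "inj_on ?w ((X \<rightarrow>\<^sub>E carrier G) \<times> ?P)"
  proof (rule inj_onI)
    fix q q' assume q: "q \<in> (X \<rightarrow>\<^sub>E carrier G) \<times> ?P" "q' \<in> (X \<rightarrow>\<^sub>E carrier G) \<times> ?P" "?w q = ?w q'"
    obtain f \<sigma> f' \<sigma>' where qq: "q = (f, \<sigma>)" "q' = (f', \<sigma>')" by (metis surj_pair)
    have f: "f \<in> X \<rightarrow>\<^sub>E carrier G" "f' \<in> X \<rightarrow>\<^sub>E carrier G"
      and s: "\<sigma> \<in> ?P" "\<sigma>' \<in> ?P" and eq: "wreath_elem G f \<sigma> = wreath_elem G f' \<sigma>'"
      using q unfolding qq by simp_all
    have *: "f i = f' i \<and> \<sigma> i = \<sigma>' i" if "i \<in> X" for i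
    proof -
      have "i \<in> dom \<sigma>" "i \<in> dom \<sigma>'"
        using that by (simp_all only: P[OF s(1)] P[OF s(2)])
      then obtain j j' where "\<sigma> i = Some j" "\<sigma>' i = Some j'"
        unfolding dom_def by auto
      moreover have "f i \<in> carrier G" "f' i \<in> carrier G" using f that by auto
      ultimately show ?thesis
        using fun_cong[OF eq, of "(\<one>\<^bsub>G\<^esub>, i)"] by (simp add: wreath_elem_def)
    qed
    have "f = f'" using f * by (intro PiE_ext) auto
    moreover have "\<sigma> = \<sigma>'" using * outside[OF s(1)] outside[OF s(2)] by (metis ext)
    ultimately show "q = q'" unfolding qq by simp
  qed
  ultimately show ?thesis
    using assms carrier_max_subgroup_wreath[OF assms(1,3,4)]
    by (simp add: card_image card_cartesian_product card_PiE)
qed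

lemma card_max_subgroup_partial_perms:
  assumes "X \<subseteq> Y" "finite X"
  shows "card (carrier (max_subgroup (partial_perms Y) (pid X))) = fact (card X)"
proof -
  let ?P = "carrier (max_subgroup (partial_perms Y) (pid X))"
  have "bij_betw (\<lambda>\<pi>. (Some \<circ> \<pi>) |` X) {\<pi>. \<pi> permutes X} ?P"
  proof (rule bij_betw_byWitness[where f' = "\<lambda>\<sigma> x. if x \<in> X then the (\<sigma> x) else x"])
    show "\<forall>\<pi>\<in>{\<pi>. \<pi> permutes X}. (\<lambda>x. if x \<in> X then the (((Some \<circ> \<pi>) |` X) x) else x) = \<pi>"
      by (auto simp: fun_eq_iff permutes_not_in)
    show "\<forall>\<sigma>\<in>?P. (Some \<circ> (\<lambda>x. if x \<in> X then the (\<sigma> x) else x)) |` X = \<sigma>"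
    proof
      fix \<sigma> assume "\<sigma> \<in> ?P"
      then have "dom \<sigma> = X" by (simp add: max_subgroup_def)
      then show "(Some \<circ> (\<lambda>x. if x \<in> X then the (\<sigma> x) else x)) |` X = \<sigma>"
        by (force simp: fun_eq_iff restrict_map_def)
    qed
    show "(\<lambda>\<pi>. (Some \<circ> \<pi>) |` X) ` {\<pi>. \<pi> permutes X} \<subseteq> ?P"
    proof clarify
      fix \<pi> assume pi: "\<pi> permutes X"
      have "dom ((Some \<circ> \<pi>) |` X) = X" by (auto simp: restrict_map_def dom_def)
      moreover have "ran ((Some \<circ> \<pi>) |` X) = \<pi> ` X"
        by (auto simp: ran_def restrict_map_def split: if_splits)
      moreover have "inj_on ((Some \<circ> \<pi>) |` X) X"
        using permutes_inj_on[OF pi, of X] by (auto simp: inj_on_def)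
      ultimately show "(Some \<circ> \<pi>) |` X \<in> ?P"
        using assms(1) permutes_image[OF pi] by (simp add: max_subgroup_def partial_perms_def)
    qed
    show "(\<lambda>\<sigma> x. if x \<in> X then the (\<sigma> x) else x) ` ?P \<subseteq> {\<pi>. \<pi> permutes X}"
    proof clarify
      fix \<sigma> assume "\<sigma> \<in> ?P"
      then have s: "dom \<sigma> = X" "ran \<sigma> = X" "inj_on \<sigma> X"
        by (auto simp: max_subgroup_def partial_perms_def)
      let ?\<pi> = "\<lambda>x. if x \<in> X then the (\<sigma> x) else x"
      have "inj_on ?\<pi> X"
        using s by (auto simp: inj_on_def dom_def)
      moreover from this have "?\<pi> ` X = X"
      proof -
        have "\<sigma> x = Some (?\<pi> x)" if "x \<in> X" for x
          using s(1) that by auto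
        then have "?\<pi> x \<in> X" if "x \<in> X" for x
          using that ranI[of \<sigma> x] unfolding s(2) by blast
        then have "?\<pi> ` X \<subseteq> X" by (rule image_subsetI)
        then show ?thesis by (rule endo_inj_surj[OF assms(2) _ \<open>inj_on ?\<pi> X\<close>])
      qed
      ultimately have "bij_betw ?\<pi> X X" by (simp add: bij_betw_def)
      then show "?\<pi> permutes X" by (rule bij_imp_permutes) auto
    qed
  qed
  then show ?thesis
    using card_permutations[OF refl assms(2)] by (simp add: bij_betw_same_card[symmetric])
qed


section \<open>The bracket\<close>

lemma rook_tensor_char_eq_card_fixed:
  assumes "finite Y"
  shows "rook_tensor_char Y p \<sigma> = of_nat (card {t \<in> tuples Y p. \<forall>y\<in>set t. \<sigma> y = Some y})"
proof -
  have "tensor_power p (rook \<sigma>) t t = (if \<forall>y\<in>set t. \<sigma> y = Some y then 1 else 0)"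
    if "t \<in> tuples Y p" for t
    using that by (auto simp: tensor_power_def rook_def tuples_def all_set_conv_all_nth
        intro!: prod.neutral prod_zero)
  then have "rook_tensor_char Y p \<sigma> = (\<Sum>t\<in>tuples Y p. if \<forall>y\<in>set t. \<sigma> y = Some y then 1 else 0)"
    unfolding rook_tensor_char_def trace_on_def by (rule sum.cong[OF refl])
  then show ?thesis
    using finite_tuples[OF assms, of p] by (simp add: sum.If_cases Int_def)
qed

text \<open>
  From \<open>(g f(i), i\<sigma>) = (g, i)\<close> it follows that \<open>f(i) = 1\<close> and \<open>i\<sigma> = i\<close>, so fixing a single point over
  \<open>i\<close> forces fixing all of \<open>G \<times> {i}\<close>.
\<close>

lemma fixing_full_support_imp_id:
  assumes "group G" "inverse_subsemigroup S I" "X \<subseteq> I"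
    and w: "w \<in> carrier (max_subgroup (wreath G I S) (pid (carrier G \<times> X)))"
    and fixed: "\<forall>y\<in>A. w y = Some y" and support: "snd ` A = X"
  shows "w = pid (carrier G \<times> X)"
proof -
  interpret group G by fact
  obtain f \<sigma> where w_eq: "w = wreath_elem G f \<sigma>" and f: "f \<in> X \<rightarrow> carrier G" and "dom \<sigma> = X"
    using w unfolding carrier_max_subgroup_wreath[OF assms(1-3)]
    by (auto simp: wreath_def max_subgroup_def)
  have "\<sigma> i = Some i \<and> f i = \<one>\<^bsub>G\<^esub>" if "i \<in> X" for i
  proof -
    have "i \<in> snd ` A" using that support by simp
    then obtain g where "(g, i) \<in> A" by auto
    then have "wreath_elem G f \<sigma> (g, i) = Some (g, i)" using fixed w_eq by auto
    then have "g \<in> carrier G" "\<sigma> i = Some i" "g \<otimes>\<^bsub>G\<^esub> f i = g"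
      by (auto simp: wreath_elem_def split: if_splits)
    moreover have "f i \<in> carrier G" using f that by auto
    ultimately show ?thesis by (simp add: r_cancel_one)
  qed
  moreover have "\<sigma> i = None" if "i \<notin> X" for i using that \<open>dom \<sigma> = X\<close> by auto
  ultimately show ?thesis
    unfolding w_eq by (force simp: wreath_elem_def restrict_map_def fun_eq_iff)
qed

lemma pinv_pid: "pinv (pid Z) = pid Z"
  by (auto simp: pinv_def ran_def fun_eq_iff restrict_map_def split: if_splits)

text \<open>
  Exchanging the two sums of the bracket turns the sum over idempotents into
  inclusion-exclusion on supports, for each group element separately.
\<close>

lemma bracket_eq_card_full_support:
  fixes \<chi> :: "('g \<times> 'i \<rightharpoonup> 'g \<times> 'i) \<Rightarrow> 'k::field"
  assumes "group G" "finite (carrier G)" "finite I"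
    and S: "inverse_subsemigroup S I" "idempotents (partial_perms I) \<subseteq> S"
    and "X \<subseteq> I"
  defines "e \<equiv> pid (carrier G \<times> X)"
  defines "H \<equiv> carrier (max_subgroup (wreath G I S) e)"
  shows "bracket (wreath G I S) e \<chi> (rook_tensor_char (carrier G \<times> I) p) =
    \<chi> e * of_nat (card {t \<in> tuples (carrier G \<times> X) p. snd ` set t = X}) / of_nat (card H)"
proof -
  interpret group G by fact
  let ?Y = "carrier G \<times> I"
  define F where "F w = {t \<in> tuples ?Y p. \<forall>y\<in>set t. w y = Some y}" for w
  have S': "S \<subseteq> partial_perms I" using S(1) by (simp add: inverse_subsemigroup_def)
  have ne: "carrier G \<noteq> {}" by blast
  have finY: "finite ?Y" using assms(2,3) by simp
  have finX: "finite X" using \<open>X \<subseteq> I\<close> \<open>finite I\<close> by (rule finite_subset)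
  have finF: "finite (F w)" for w
    unfolding F_def using finite_tuples[OF finY, of p] by simp
  have e_idem: "e \<in> idempotents (wreath G I S)"
    unfolding e_def using idempotents_wreath[OF assms(1) S' S(2)] \<open>X \<subseteq> I\<close> by auto
  have eH: "e \<in> H"
    using e_idem by (auto simp: H_def max_subgroup_def idempotents_def e_def dom_pid ran_pid)
  have finH: "finite H"
    by (rule finite_subset[OF _ finite_set_of_finite_maps[of "carrier G \<times> X" "carrier G \<times> X"]])
      (use assms(2) finX in \<open>auto simp: H_def max_subgroup_def e_def\<close>)
  have below: "{f \<in> idempotents (wreath G I S). f \<subseteq>\<^sub>m e} = (\<lambda>Z. pid (carrier G \<times> Z)) ` Pow X"
    unfolding idempotents_wreath[OF assms(1) S' S(2)] e_def
    using ne \<open>X \<subseteq> I\<close> by (auto simp: pid_map_le_iff times_subset_iff)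
  have char: "rook_tensor_char ?Y p (pcomp (pid (carrier G \<times> Z)) w) =
      (of_nat (card {t \<in> F w. snd ` set t \<subseteq> Z}) :: 'k)" for Z w
  proof -
    have "pcomp (pid (carrier G \<times> Z)) w y = Some y \<longleftrightarrow> w y = Some y \<and> snd y \<in> Z" if "y \<in> ?Y" for y
      using that by (cases y) (auto simp: pcomp_def map_comp_def restrict_map_def)
    then have "{t \<in> tuples ?Y p. \<forall>y\<in>set t. pcomp (pid (carrier G \<times> Z)) w y = Some y} =
        {t \<in> F w. snd ` set t \<subseteq> Z}"
      unfolding F_def tuples_def by blast
    then show ?thesis by (simp add: rook_tensor_char_eq_card_fixed[OF finY])
  qed
  have "bracket (wreath G I S) e \<chi> (rook_tensor_char ?Y p) =
      (\<Sum>Z\<in>Pow X. (1 / of_nat (card H) *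
        (\<Sum>w\<in>H. \<chi> (pinv w) * of_nat (card {t \<in> F w. snd ` set t \<subseteq> Z}))) * (-1) ^ (card X - card Z))"
    unfolding bracket_def below H_def[symmetric]
    using mobius_wreath[OF assms(1) S' S(2) \<open>finite I\<close> _ \<open>X \<subseteq> I\<close>]
    by (subst sum.reindex[OF inj_on_subset[OF inj_pid_Times[OF ne] subset_UNIV]])
      (simp add: char e_def)
  also have "\<dots> = 1 / of_nat (card H) * (\<Sum>w\<in>H. \<chi> (pinv w) *
      (\<Sum>Z\<in>Pow X. (-1) ^ (card X - card Z) * of_nat (card {t \<in> F w. snd ` set t \<subseteq> Z})))"
    unfolding sum_distrib_left sum_distrib_right
    by (subst sum.swap) (simp add: mult_ac)
  also have "\<dots> = 1 / of_nat (card H) *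
      (\<Sum>w\<in>H. \<chi> (pinv w) * of_nat (card {t \<in> F w. snd ` set t = X}))"
    by (simp add: card_full_support_inclusion_exclusion[OF finF finX])
  \<comment> \<open>An element fixing every entry of a tuple with support \<open>X\<close> is the identity \<open>e\<close>.\<close>
  also have "(\<Sum>w\<in>H. \<chi> (pinv w) * of_nat (card {t \<in> F w. snd ` set t = X})) =
      (\<Sum>w\<in>{e}. \<chi> (pinv w) * of_nat (card {t \<in> F w. snd ` set t = X}))"
  proof (rule sum.mono_neutral_right[OF finH])
    show "\<forall>w\<in>H - {e}. \<chi> (pinv w) * of_nat (card {t \<in> F w. snd ` set t = X}) = 0"
    proof
      fix w assume "w \<in> H - {e}"
      then have "{t \<in> F w. snd ` set t = X} = {}"
        using fixing_full_support_imp_id[OF assms(1) S(1) \<open>X \<subseteq> I\<close>, of w]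
        by (auto simp: F_def H_def e_def)
      then show "\<chi> (pinv w) * of_nat (card {t \<in> F w. snd ` set t = X}) = 0"
        by (simp only: card.empty of_nat_0 mult_zero_right)
    qed
  qed (use eH in auto)
  also have "\<dots> = \<chi> e * of_nat (card {t \<in> F e. snd ` set t = X})"
    by (simp add: e_def pinv_pid)
  also have "{t \<in> F e. snd ` set t = X} = {t \<in> tuples (carrier G \<times> X) p. snd ` set t = X}"
    using \<open>X \<subseteq> I\<close> by (auto simp: F_def e_def tuples_def pid_eq_Some_iff)
  finally show ?thesis by simp
qed

theorem theorem6p4:
  fixes G :: "('g, 'b) monoid_scheme"
    and n p r :: nat
    and S :: "(nat \<rightharpoonup> nat) set"
    and X :: "nat set"
    and \<chi> :: "('g \<times> nat \<rightharpoonup> 'g \<times> nat) \<Rightarrow> 'k::{alg_closed_field, field_char_0}"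
  assumes "inverse_subsemigroup S {1..n}"
    and "idempotents (partial_perms {1..n}) \<subseteq> S"
    and "group G" and "finite (carrier G)"
    and "p \<ge> 1"
    and "X \<subseteq> {1..n}" and "card X = r"
    and "\<chi> \<in> Irr (max_subgroup (wreath G {1..n} S) (pid (carrier G \<times> X)))"
  shows "bracket (wreath G {1..n} S) (pid (carrier G \<times> X)) \<chi>
             (rook_tensor_char (carrier G \<times> {1..n}) p)
           = 1 / (of_nat (card (carrier G)) powi (int r - int p) * of_nat (card (carrier (max_subgroup S (pid X)))))
             * char_degree (max_subgroup (wreath G {1..n} S) (pid (carrier G \<times> X))) \<chi>
             * fact r * of_nat (Stirling p r)
         \<and>
         (S = partial_perms {1..n} \<longrightarrow>
           bracket (wreath G {1..n} S) (pid (carrier G \<times> X)) \<chi>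
             (rook_tensor_char (carrier G \<times> {1..n}) p)
           = 1 / of_nat (card (carrier G)) powi (int r - int p)
             * char_degree (max_subgroup (wreath G {1..n} S) (pid (carrier G \<times> X))) \<chi>
             * of_nat (Stirling p r))"
proof -
  let ?I = "{1..n}"
  let ?e = "pid (carrier G \<times> X)"
  let ?W = "wreath G ?I S"
  let ?P = "carrier (max_subgroup S (pid X))"
  interpret group G by fact
  have finX: "finite X" using assms(6) finite_subset by blast
  have deg: "char_degree (max_subgroup ?W ?e) \<chi> = \<chi> ?e"
    by (simp add: char_degree_def max_subgroup_def)
  have G0: "(of_nat (card (carrier G)) :: 'k) \<noteq> 0"
    using assms(4) one_closed by (auto simp: card_eq_0_iff)
  have "bracket ?W ?e \<chi> (rook_tensor_char (carrier G \<times> ?I) p) =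
      \<chi> ?e * (of_nat (card (carrier G)) ^ p * (fact r * of_nat (Stirling p r)))
        / (of_nat (card (carrier G)) ^ r * of_nat (card ?P))"
    using bracket_eq_card_full_support[OF assms(3,4) finite_atLeastAtMost assms(1,2,6), of \<chi> p]
      card_max_subgroup_wreath[OF assms(3,4,1,6) finX]
      card_full_support_tuples[OF assms(4) finX, of p] assms(7)
    by simp
  also have "\<dots> = 1 / (of_nat (card (carrier G)) powi (int r - int p) * of_nat (card ?P))
      * \<chi> ?e * fact r * of_nat (Stirling p r)"
    using G0 by (simp add: power_int_diff field_simps)
  finally have main: "bracket ?W ?e \<chi> (rook_tensor_char (carrier G \<times> ?I) p) =
      1 / (of_nat (card (carrier G)) powi (int r - int p) * of_nat (card ?P))
      * \<chi> ?e * fact r * of_nat (Stirling p r)" .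
  moreover have "card ?P = fact r" if "S = partial_perms ?I"
    using card_max_subgroup_partial_perms[OF assms(6) finX] that assms(7) by simp
  ultimately show ?thesis
    unfolding deg by (auto simp: of_nat_fact)
qed

end
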